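(* Let $\mathbb{H}$ be the division ring of quaternions, let $\mathbb{H}[x_1,\dots,x_n]$ be the ring of polynomials over $\mathbb{H}$ in $n$ central indeterminates, let $I$ be a left ideal of $\mathbb{H}[x_1,\dots,x_n]$, and let $F\in\mathbb{H}[x_1,\dots,x_n]$. Then $F$ vanishes on the zero locus $\mathcal{V}(I)$ of $I$ (that is, $F(p)=0$ for all $p\in\mathcal{V}(I)$) if and only if for every $a\in\mathbb{H}$ there exists a natural number $N\geq 1$ such that \[ (aF)^N\in I+I(aF)+I(aF)^2+\cdots+I(aF)^N. \]
   Context: The indeterminates $x_1,\dots,x_n$ in $\mathbb{H}[x_1,\dots,x_n]$ are central: they commute with each other and with all elements of $\mathbb{H}$ (the coefficients need not commute with each other). Let $\mathbb{H}^n_c$ denote the set of points $(a_1,\dots,a_n)\in\mathbb{H}^n$ such that $a_ra_s=a_sa_r$ for all $r,s$. For every $p=(a_1,\dots,a_n)\in\mathbb{H}^n_c$ and $F\in\mathbb{H}[x_1,\dots,x_n]$ there is a unique element $F(p)=F(a_1,\dots,a_n)\in\mathbb{H}$, called the evaluation of $F$ at $p$, such that \[ F-F(p)\in\sum_{m=1}^n\mathbb{H}[x_1,\dots,x_n]\,(x_m-a_m), \] the left ideal generated by $x_1-a_1,\dots,x_n-a_n$. For a left ideal $I$ of $\mathbb{H}[x_1,\dots,x_n]$, its zero locus is $\mathcal{V}(I)=\{p\in\mathbb{H}^n_c : G(p)=0 \text{ for all } G\in I\}$. For a polynomial $P$ and $m\ge 1$, $IP^m=\{GP^m : G\in I\}$,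 and $I+IP+\cdots+IP^N$ is the set of all sums $G_0+G_1P+\cdots+G_NP^N$ with $G_0,\dots,G_N\in I$. Here $aF$ is the product in $\mathbb{H}[x_1,\dots,x_n]$ of the constant $a$ and $F$. *)

theory Defs
  imports Complex_Main "HOL-Library.Poly_Mapping"
begin

section \<open>Quaternions\<close>

datatype quat = Quat (qRe: real) (qI: real) (qJ: real) (qK: real)

lemma quat_eq_iff:
  "p = q \<longleftrightarrow> qRe p = qRe q \<and> qI p = qI q \<and> qJ p = qJ q \<and> qK p = qK q"
  by (cases p; cases q) simp

definition qnorm2 :: "quat \<Rightarrow> real" where
  "qnorm2 p = (qRe p)\<^sup>2 + (qI p)\<^sup>2 + (qJ p)\<^sup>2 + (qK p)\<^sup>2"

lemma qnorm2_eq_0_iff: "qnorm2 p = 0 \<longleftrightarrow> p = Quat 0 0 0 0"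
  by (cases p) (auto simp: qnorm2_def add_nonneg_eq_0_iff)

instantiation quat :: division_ring
begin

definition zero_quat :: quat where "0 = Quat 0 0 0 0"

definition one_quat :: quat where "1 = Quat 1 0 0 0"

definition plus_quat :: "quat \<Rightarrow> quat \<Rightarrow> quat" where
  "p + q = Quat (qRe p + qRe q) (qI p + qI q) (qJ p + qJ q) (qK p + qK q)"

definition uminus_quat :: "quat \<Rightarrow> quat" where
  "- p = Quat (- qRe p) (- qI p) (- qJ p) (- qK p)"

definition minus_quat :: "quat \<Rightarrow> quat \<Rightarrow> quat" where
  "p - q = Quat (qRe p - qRe q) (qI p - qI q) (qJ p - qJ q) (qK p - qK q)"

definition times_quat :: "quat \<Rightarrow> quat \<Rightarrow> quat" where
  "p * q = Quat
     (qRe p * qRe q - qI p * qI q - qJ p * qJ q - qK p * qK q)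
     (qRe p * qI q + qI p * qRe q + qJ p * qK q - qK p * qJ q)
     (qRe p * qJ q - qI p * qK q + qJ p * qRe q + qK p * qI q)
     (qRe p * qK q + qI p * qJ q - qJ p * qI q + qK p * qRe q)"

definition inverse_quat :: "quat \<Rightarrow> quat" where
  "inverse p = Quat (qRe p / qnorm2 p) (- qI p / qnorm2 p) (- qJ p / qnorm2 p) (- qK p / qnorm2 p)"

definition "p div (q :: quat) = p * inverse q"

instance
proof
  fix p q r :: quat
  show "p * q * r = p * (q * r)" "(p + q) * r = p * r + q * r" "p * (q + r) = p * q + p * r"
    by (simp_all add: quat_eq_iff times_quat_def plus_quat_def algebra_simps)
  show "p + q + r = p + (q + r)" "p + q = q + p" "0 + p = p" "- p + p = 0" "p - q = p + - q"
    "1 * p = p" "p * 1 = p" "(0 :: quat) \<noteq> 1"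
    by (simp_all add: quat_eq_iff times_quat_def plus_quat_def uminus_quat_def minus_quat_def
        zero_quat_def one_quat_def)
  show "p div q = p * inverse q" by (simp add: divide_quat_def)
  show "inverse (0 :: quat) = 0" by (simp add: inverse_quat_def zero_quat_def)
  assume "p \<noteq> 0"
  then have n: "qnorm2 p \<noteq> 0" by (simp add: qnorm2_eq_0_iff zero_quat_def)
  have *: "qRe p * qRe p / qnorm2 p + qI p * qI p / qnorm2 p + qJ p * qJ p / qnorm2 p
      + qK p * qK p / qnorm2 p = 1"
    using n by (simp add: qnorm2_def power2_eq_square flip: add_divide_distrib)
  show "inverse p * p = 1" "p * inverse p = 1"
    using * by (simp_all add: quat_eq_iff times_quat_def inverse_quat_def one_quat_def algebra_simps)
qed

end


section \<open>Polynomials in central indeterminates\<close>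

text \<open>
  A polynomial is a finitely supported family of coefficients indexed by exponent vectors,
  with the convolution product of \<^theory>\<open>HOL-Library.Poly_Mapping\<close>, which does not
  require the coefficients to commute. The indeterminates are indexed by a finite type
  \<open>'n\<close>, whose cardinality is the number of indeterminates.
\<close>

type_synonym 'n qpoly = "('n \<Rightarrow>\<^sub>0 nat) \<Rightarrow>\<^sub>0 quat"

definition qconst :: "quat \<Rightarrow> 'n qpoly" where
  "qconst c = Poly_Mapping.single 0 c"

definition qvar :: "'n \<Rightarrow> 'n qpoly" where
  "qvar m = Poly_Mapping.single (Poly_Mapping.single m 1) 1"

definition commuting_points :: "('n \<Rightarrow> quat) set" where
  "commuting_points = {a. \<forall>r s. a r * a s = a s * a r}"

text \<open>The left ideal generated by the polynomials \<open>qvar m - qconst (a m)\<close>.\<close>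

definition point_ideal :: "('n::finite \<Rightarrow> quat) \<Rightarrow> 'n qpoly set" where
  "point_ideal a = {\<Sum>m\<in>UNIV. G m * (qvar m - qconst (a m)) | G. True}"

text \<open>Meaningful only for \<open>a \<in> commuting_points\<close>; see \<open>ex1_qeval\<close> below.\<close>

definition qeval :: "'n qpoly \<Rightarrow> ('n::finite \<Rightarrow> quat) \<Rightarrow> quat" where
  "qeval F a = (THE c. F - qconst c \<in> point_ideal a)"

definition left_ideal :: "'n qpoly set \<Rightarrow> bool" where
  "left_ideal I \<longleftrightarrow> 0 \<in> I \<and> (\<forall>F\<in>I. \<forall>G\<in>I. F + G \<in> I) \<and> (\<forall>H. \<forall>G\<in>I. H * G \<in> I)"

definition zero_locus :: "'n::finite qpoly set \<Rightarrow> ('n \<Rightarrow> quat) set" where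
  "zero_locus I = {p \<in> commuting_points. \<forall>G\<in>I. qeval G p = 0}"

text \<open>The set \<open>I + I P + \<dots> + I P\<^sup>N\<close>.\<close>

definition power_sum_set :: "'n qpoly set \<Rightarrow> 'n qpoly \<Rightarrow> nat \<Rightarrow> 'n qpoly set" where
  "power_sum_set I P N = {\<Sum>k\<le>N. G k * P ^ k | G. \<forall>k\<le>N. G k \<in> I}"


section \<open>Evaluation is well defined\<close>

lemma qpoly_induct [case_names zero add single]:
  fixes F :: "'n qpoly"
  assumes "P 0" and "\<And>F G. P F \<Longrightarrow> P G \<Longrightarrow> P (F + G)"
    and "\<And>k c. P (Poly_Mapping.single k c)"
  shows "P F"
proof (induction F rule: update_induct)
  case const
  then show ?case using assms(1) by simp
next
  case (update f k v)
  have "Poly_Mapping.update k v f = f + Poly_Mapping.single k v"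
    using update(1) by (intro poly_mapping_eqI)
      (auto simp: lookup_update lookup_add lookup_single when_def in_keys_iff)
  then show ?case using update assms by simp
qed

lemma qvar_central: "qvar m * F = F * qvar m"
  by (induction F rule: qpoly_induct)
    (simp_all add: distrib_left distrib_right qvar_def mult_single add.commute)

lemma point_ideal_add:
  assumes "F \<in> point_ideal a" "G \<in> point_ideal a" shows "F + G \<in> point_ideal a"
proof -
  from assms obtain f g where "F = (\<Sum>m\<in>UNIV. f m * (qvar m - qconst (a m)))"
    "G = (\<Sum>m\<in>UNIV. g m * (qvar m - qconst (a m)))"
    by (auto simp: point_ideal_def)
  then have "F + G = (\<Sum>m\<in>UNIV. (f m + g m) * (qvar m - qconst (a m)))"
    by (simp add: distrib_right sum.distrib)
  then show ?thesis unfolding point_ideal_def by (intro CollectI exI[of _ "\<lambda>m. f m + g m"]) simp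
qed

lemma point_ideal_mult:
  assumes "F \<in> point_ideal a" shows "H * F \<in> point_ideal a"
proof -
  from assms obtain f where "F = (\<Sum>m\<in>UNIV. f m * (qvar m - qconst (a m)))"
    by (auto simp: point_ideal_def)
  then have "H * F = (\<Sum>m\<in>UNIV. (H * f m) * (qvar m - qconst (a m)))"
    by (simp add: sum_distrib_left mult.assoc)
  then show ?thesis unfolding point_ideal_def by (intro CollectI exI[of _ "\<lambda>m. H * f m"]) simp
qed

lemma point_ideal_generator: "qvar m - qconst (a m) \<in> point_ideal a"
proof -
  have "(\<Sum>l\<in>UNIV. (if l = m then 1 else 0) * (qvar l - qconst (a l)))
      = (\<Sum>l\<in>UNIV. if l = m then qvar l - qconst (a l) else 0)"
    by (intro sum.cong) auto
  then show ?thesis unfolding point_ideal_def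
    by (intro CollectI exI[of _ "\<lambda>l. if l = m then 1 else 0"]) (simp add: sum.delta)
qed

lemma point_ideal_zero: "0 \<in> point_ideal a"
  using point_ideal_mult[OF point_ideal_generator, of 0] by simp

lemma left_ideal_point_ideal: "left_ideal (point_ideal a)"
  by (simp add: left_ideal_def point_ideal_zero point_ideal_add point_ideal_mult)

lemma ex_qeval: "\<exists>c. F - qconst c \<in> point_ideal a"
proof (induction F rule: qpoly_induct)
  case zero
  then show ?case by (intro exI[of _ 0]) (simp add: qconst_def point_ideal_zero)
next
  case (add F G)
  then obtain c d where "F - qconst c \<in> point_ideal a" "G - qconst d \<in> point_ideal a" by auto
  from point_ideal_add[OF this] show ?case
    by (intro exI[of _ "c + d"]) (simp add: qconst_def single_add algebra_simps)
next
  case (single k c)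
  have step: "\<exists>d. F * qvar m - qconst d \<in> point_ideal a"
    if "\<exists>d. F - qconst d \<in> point_ideal a" for F :: "'a qpoly" and m
  proof -
    from that obtain d where d: "F - qconst d \<in> point_ideal a" by auto
    have "qvar m * (F - qconst d) + qconst d * (qvar m - qconst (a m)) \<in> point_ideal a"
      by (intro point_ideal_add point_ideal_mult d point_ideal_generator)
    also have "qvar m * (F - qconst d) + qconst d * (qvar m - qconst (a m))
        = F * qvar m - qconst (d * a m)"
      by (simp add: algebra_simps qvar_central[of m]) (simp add: qconst_def mult_single)
    finally show ?thesis by auto
  qed
  have pow: "\<exists>d. F * qvar m ^ j - qconst d \<in> point_ideal a"
    if "\<exists>d. F - qconst d \<in> point_ideal a" for F :: "'a qpoly" and m j
    using that
  proof (induction j arbitrary: F)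
    case (Suc j)
    from Suc.IH[OF step[OF Suc.prems, of m]] show ?case by (simp add: mult.assoc)
  qed simp
  have vpow: "Poly_Mapping.single (Poly_Mapping.single m j) 1 = qvar m ^ j" for m :: 'a and j
  proof (induction j)
    case (Suc j)
    have "Poly_Mapping.single (Poly_Mapping.single m (Suc j)) (1 :: quat)
        = qvar m * Poly_Mapping.single (Poly_Mapping.single m j) 1"
      by (simp add: qvar_def mult_single flip: single_add)
    with Suc show ?case by simp
  qed simp
  show ?case
  proof (induction k rule: update_induct)
    case const
    then show ?case by (intro exI[of _ c]) (simp add: qconst_def point_ideal_zero)
  next
    case (update k m j)
    have "Poly_Mapping.update m j k = k + Poly_Mapping.single m j"
      using update(1) by (intro poly_mapping_eqI)
        (auto simp: lookup_update lookup_add lookup_single when_def in_keys_iff)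
    then have "Poly_Mapping.single (Poly_Mapping.update m j k) c
        = Poly_Mapping.single k c * qvar m ^ j"
      by (simp add: mult_single flip: vpow)
    then show ?case using pow[OF update(3), of m j] by simp
  qed
qed

lemma qconst_in_point_ideal:
  fixes a :: "'n::finite \<Rightarrow> quat"
  assumes "a \<in> commuting_points" "qconst c \<in> point_ideal a"
  shows "c = 0"
proof -
  have comm: "a r * a s = a s * a r" for r s
    using assms(1) by (auto simp: commuting_points_def)
  have commp: "a r * a s ^ j = a s ^ j * a r" for r s j
    by (induction j) (simp_all add: comm mult.assoc, metis comm mult.assoc)
  obtain xs :: "'n list" where xs: "distinct xs" "set xs = UNIV"
    using finite_distinct_list[OF finite_UNIV] by auto
  define E where "E ys k = prod_list (map (\<lambda>s. a s ^ Poly_Mapping.lookup k s) ys)"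
    for ys and k :: "'n \<Rightarrow>\<^sub>0 nat"
  have commE: "a r * E ys k = E ys k * a r" for r ys k
  proof (induction ys)
    case (Cons y ys)
    have "a r * E (y # ys) k = (a r * a y ^ Poly_Mapping.lookup k y) * E ys k"
      by (simp add: E_def mult.assoc)
    also have "\<dots> = a y ^ Poly_Mapping.lookup k y * (a r * E ys k)"
      by (simp add: commp mult.assoc)
    also have "\<dots> = E (y # ys) k * a r"
      by (subst Cons) (simp add: E_def mult.assoc)
    finally show ?case .
  qed (simp add: E_def)
  have notin: "E ys (k + Poly_Mapping.single m 1) = E ys k" if "m \<notin> set ys" for ys k m
    unfolding E_def using that
    by (intro arg_cong[where f = prod_list] map_cong) (auto simp: lookup_add lookup_single when_def)
  have shift: "E ys (k + Poly_Mapping.single m 1) = E ys k * a m"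
    if "distinct ys" "m \<in> set ys" for ys k m
    using that
  proof (induction ys)
    case (Cons y ys)
    have E_Cons: "E (y # ys) k = a y ^ Poly_Mapping.lookup k y * E ys k" for k
      by (simp add: E_def)
    show ?case
    proof (cases "y = m")
      case True
      then have "m \<notin> set ys" using Cons.prems by simp
      then have "E (y # ys) (k + Poly_Mapping.single m 1)
          = a m ^ Poly_Mapping.lookup k m * (a m * E ys k)"
        unfolding E_Cons notin[OF \<open>m \<notin> set ys\<close>]
        using True by (simp add: lookup_add power_Suc2 mult.assoc del: power_Suc)
      then show ?thesis unfolding E_Cons[of k] using True by (simp add: commE mult.assoc)
    next
      case False
      then have "E ys (k + Poly_Mapping.single m 1) = E ys k * a m"
        using Cons by auto
      then show ?thesis unfolding E_Cons
        using False by (simp add: lookup_add lookup_single when_def mult.assoc)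
    qed
  qed simp
  define ev where "ev F = (\<Sum>k\<in>Poly_Mapping.keys F. Poly_Mapping.lookup F k * E xs k)" for F :: "'n qpoly"
  have ev_superset: "ev F = (\<Sum>k\<in>A. Poly_Mapping.lookup F k * E xs k)"
    if "finite A" "Poly_Mapping.keys F \<subseteq> A" for F A
    unfolding ev_def by (intro sum.mono_neutral_left that) (simp add: in_keys_iff)
  have ev_add: "ev (F + G) = ev F + ev G" for F G
  proof -
    let ?A = "Poly_Mapping.keys F \<union> Poly_Mapping.keys G"
    have "ev (F + G) = (\<Sum>k\<in>?A. Poly_Mapping.lookup (F + G) k * E xs k)"
      by (intro ev_superset) (auto simp: in_keys_iff lookup_add)
    also have "\<dots> = ev F + ev G"
      by (subst (1 2) ev_superset[of ?A]) (auto simp: lookup_add distrib_right sum.distrib)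
    finally show ?thesis .
  qed
  have ev_single: "ev (Poly_Mapping.single k c) = c * E xs k" for k c
    by (subst ev_superset[of "{k}"]) auto
  have ev_0: "ev 0 = 0" by (simp add: ev_def)
  have ev_uminus: "ev (- F) = - ev F" for F
    using ev_add[of F "- F"] by (simp add: ev_0 eq_neg_iff_add_eq_0 add.commute)
  have ev_gen: "ev (G * (qvar m - qconst (a m))) = 0" for G m
  proof (induction G rule: qpoly_induct)
    case (single k d)
    have "Poly_Mapping.single k d * (qvar m - qconst (a m))
        = Poly_Mapping.single (k + Poly_Mapping.single m 1) d + - Poly_Mapping.single k (d * a m)"
      by (simp add: qvar_def qconst_def right_diff_distrib mult_single)
    then show ?case
      using shift[OF xs(1), of m k] xs(2)
      by (simp only: ev_add ev_uminus ev_single) (simp add: commE mult.assoc)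
  qed (simp_all add: ev_0 ev_add distrib_right)
  have ev_sum: "ev (\<Sum>m\<in>A. g m) = (\<Sum>m\<in>A. ev (g m))" for A :: "'n set" and g
    by (induction A rule: infinite_finite_induct) (simp_all add: ev_0 ev_add)
  have "ev (qconst c) = 0"
    using assms(2) by (auto simp: point_ideal_def ev_sum ev_gen)
  moreover have "E xs 0 = 1" unfolding E_def by (induction xs) auto
  ultimately show ?thesis by (simp add: qconst_def ev_single)
qed

lemma ex1_qeval:
  assumes "a \<in> commuting_points"
  shows "\<exists>!c. F - qconst c \<in> point_ideal a"
proof (rule ex_ex1I[OF ex_qeval])
  fix c d assume *: "F - qconst c \<in> point_ideal a" "F - qconst d \<in> point_ideal a"
  have "(F - qconst d) + (- 1) * (F - qconst c) \<in> point_ideal a"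
    by (intro point_ideal_add point_ideal_mult *)
  also have "(F - qconst d) + (- 1) * (F - qconst c) = qconst (c - d)"
    by (simp add: qconst_def single_diff)
  finally show "c = d" using qconst_in_point_ideal[OF assms] by fastforce
qed

lemma qeval_in_point_ideal:
  "a \<in> commuting_points \<Longrightarrow> F - qconst (qeval F a) \<in> point_ideal a"
  unfolding qeval_def by (rule theI'[OF ex1_qeval])

end

theory Submission
  imports Defs "HOL-Library.Countable_Set" "HOL-Analysis.Continuum_Not_Denumerable"
    "HOL-Computational_Algebra.Fundamental_Theorem_Algebra"
begin

text \<open>
  Write \<open>R\<close> for the polynomial ring and, for a commuting point \<open>p\<close>, \<open>m\<^sub>p\<close> for the left ideal
  generated by the \<open>x\<^sub>i - p\<^sub>i\<close>, so that \<open>F(p) = 0\<close> means \<open>F \<in> m\<^sub>p\<close>.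

  Suppose that the power condition holds and that \<open>p\<close> is a zero of \<open>I\<close> with \<open>F(p) \<noteq> 0\<close>. Scaling by
  \<open>a = F(p)\<^sup>-\<^sup>1\<close> gives \<open>P = a F\<close> with \<open>P \<equiv> 1\<close> modulo \<open>m\<^sub>p\<close>. Right multiplication by such a \<open>P\<close> is the
  identity modulo the left ideal \<open>m\<^sub>p\<close>, so \<open>I P\<^sup>k\<close> is contained in \<open>m\<^sub>p\<close> for every \<open>k\<close>, while
  \<open>P\<^sup>N \<equiv> 1\<close>; the power condition then forces \<open>1 \<in> m\<^sub>p\<close> (\<open>power_sum_set_qeval\<close>). The freedom to
  choose \<open>a\<close> is essential here: without it, right multiplication by \<open>P\<close> need not preserve \<open>m\<^sub>p\<close>.

  Conversely, let \<open>F\<close> vanish on the zero locus. So does \<open>P = a F\<close>, and Rabinowitsch's trick applies: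
  adjoin a central indeterminate \<open>y\<close> and consider the left ideal \<open>L\<close> of \<open>R[y]\<close> generated by \<open>I\<close> and
  \<open>1 - y P\<close>. If \<open>1 \<in> L\<close>, substituting \<open>P\<^sup>-\<^sup>1\<close> for \<open>y\<close> on the right and clearing denominators yields
  the power condition (\<open>one_in_rabinowitsch_ideal\<close>). Otherwise \<open>L\<close> lies in a maximal left ideal
  \<open>M\<close>, and the weak Nullstellensatz (\<open>maximal_left_ideal_point\<close>) provides commuting quaternions
  \<open>p\<^sub>i\<close> with \<open>x\<^sub>i - p\<^sub>i \<in> M\<close>. Then \<open>p\<close> is a zero of \<open>I\<close>, so \<open>P\<close> vanishes at \<open>p\<close> and \<open>P \<in> M\<close>; with
  \<open>1 - y P \<in> M\<close> this gives \<open>1 \<in> M\<close>, a contradiction.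

  The weak Nullstellensatz rests on a cardinality argument. Let \<open>M\<close> be a maximal left ideal of a ring
  \<open>S\<close> generated by the quaternions and finitely many central elements \<open>z\<^sub>i\<close>. As a complex vector space
  \<open>S\<close> has countable dimension, so for \<open>w \<notin> M\<close> the uncountably many fractions \<open>w / (z\<^sub>i - r)\<close>, \<open>r\<close> real,
  which exist in the simple module \<open>S / M\<close> unless \<open>z\<^sub>i\<close> has a real eigenvalue on \<open>w\<close>, are linearly
  dependent, and \<open>f(z\<^sub>i) w \<in> M\<close> for some nonzero complex polynomial \<open>f\<close>
  (\<open>annihilating_polynomial\<close>). Splitting \<open>f\<close> into linear factors produces an eigenvector, and doing
  this for one \<open>i\<close> after the other a joint eigenvector \<open>w\<close> with complex eigenvalues \<open>b\<^sub>i\<close>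
  (\<open>joint_eigenvector\<close>). Since \<open>w\<close> generates \<open>S / M\<close> and the \<open>z\<^sub>i\<close> act on it by scalars, \<open>S / M\<close> is a line
  over the quaternions: \<open>1 \<equiv> h w\<close> for a quaternion \<open>h\<close>, and hence \<open>z\<^sub>i \<equiv> h b\<^sub>i h\<^sup>-\<^sup>1\<close>. These conjugates
  of complex numbers by the same \<open>h\<close> commute with each other.
\<close>

section \<open>Left ideals and left congruences\<close>

text \<open>The counterpart of \<^const>\<open>left_ideal\<close> for arbitrary rings, used for \<open>R[y]\<close> as well.\<close>

definition is_left_ideal :: "'s::ring_1 set \<Rightarrow> bool" where
  "is_left_ideal M \<longleftrightarrow> 0 \<in> M \<and> (\<forall>s\<in>M. \<forall>t\<in>M. s + t \<in> M) \<and> (\<forall>r. \<forall>s\<in>M. r * s \<in> M)"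

definition maximal_left_ideal :: "'s::ring_1 set \<Rightarrow> bool" where
  "maximal_left_ideal M \<longleftrightarrow> is_left_ideal M \<and> 1 \<notin> M \<and>
     (\<forall>K. is_left_ideal K \<and> 1 \<notin> K \<and> M \<subseteq> K \<longrightarrow> K = M)"

definition left_cong :: "'s::ring_1 set \<Rightarrow> 's \<Rightarrow> 's \<Rightarrow> bool" where
  "left_cong M s t \<longleftrightarrow> s - t \<in> M"

lemma is_left_idealD:
  assumes "is_left_ideal M"
  shows "0 \<in> M" "s \<in> M \<Longrightarrow> t \<in> M \<Longrightarrow> s + t \<in> M" "s \<in> M \<Longrightarrow> r * s \<in> M"
    "s \<in> M \<Longrightarrow> - s \<in> M" "s \<in> M \<Longrightarrow> t \<in> M \<Longrightarrow> s - t \<in> M"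
proof -
  show *: "0 \<in> M" "s \<in> M \<Longrightarrow> t \<in> M \<Longrightarrow> s + t \<in> M" "s \<in> M \<Longrightarrow> r * s \<in> M" for s t r
    using assms by (auto simp: is_left_ideal_def)
  show uminus: "s \<in> M \<Longrightarrow> - s \<in> M" for s
    using *(3)[of s "- 1"] by simp
  show "s \<in> M \<Longrightarrow> t \<in> M \<Longrightarrow> s - t \<in> M"
    using *(2)[of s "- t"] uminus[of t] by simp
qed

lemma is_left_ideal_sum:
  assumes "is_left_ideal M" "\<And>i. i \<in> A \<Longrightarrow> f i \<in> M"
  shows "sum f A \<in> M"
  using assms(2)
  by (induction A rule: infinite_finite_induct) (simp_all add: is_left_idealD[OF assms(1)])

lemma left_cong_refl: "is_left_ideal M \<Longrightarrow> left_cong M s s"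
  by (simp add: left_cong_def is_left_idealD)

lemma left_cong_sym: "is_left_ideal M \<Longrightarrow> left_cong M s t \<Longrightarrow> left_cong M t s"
  unfolding left_cong_def using is_left_idealD(4)[of M "s - t"] by simp

lemma left_cong_trans:
  "is_left_ideal M \<Longrightarrow> left_cong M r s \<Longrightarrow> left_cong M s t \<Longrightarrow> left_cong M r t"
  unfolding left_cong_def using is_left_idealD(2)[of M "r - s" "s - t"] by simp

lemma left_cong_add:
  "is_left_ideal M \<Longrightarrow> left_cong M s t \<Longrightarrow> left_cong M s' t' \<Longrightarrow> left_cong M (s + s') (t + t')"
  unfolding left_cong_def using is_left_idealD(2)[of M "s - t" "s' - t'"] by (simp add: algebra_simps)

lemma left_cong_mult: "is_left_ideal M \<Longrightarrow> left_cong M s t \<Longrightarrow> left_cong M (r * s) (r * t)"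
  unfolding left_cong_def using is_left_idealD(3)[of M "s - t" r] by (simp add: algebra_simps)

lemma left_cong_mem: "is_left_ideal M \<Longrightarrow> left_cong M s t \<Longrightarrow> t \<in> M \<Longrightarrow> s \<in> M"
  unfolding left_cong_def using is_left_idealD(2)[of M "s - t" t] by simp

lemma ex_maximal_left_ideal:
  assumes L: "is_left_ideal L" "1 \<notin> L"
  shows "\<exists>M. maximal_left_ideal M \<and> L \<subseteq> M"
proof -
  let ?A = "{K. is_left_ideal K \<and> 1 \<notin> K \<and> L \<subseteq> K}"
  have "\<exists>M\<in>?A. \<forall>K\<in>?A. M \<subseteq> K \<longrightarrow> K = M"
  proof (rule subset_Zorn_nonempty)
    show "?A \<noteq> {}" using L by auto
    fix C assume C: "C \<noteq> {}" "subset.chain ?A C"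
    then have sub: "C \<subseteq> ?A" and chain: "\<And>X Y. X \<in> C \<Longrightarrow> Y \<in> C \<Longrightarrow> X \<subseteq> Y \<or> Y \<subseteq> X"
      by (auto simp: subset_chain_def)
    have "is_left_ideal (\<Union>C)"
      unfolding is_left_ideal_def
    proof (intro conjI ballI allI)
      show "0 \<in> \<Union>C" using C(1) sub by (auto simp: is_left_ideal_def)
      show "r * s \<in> \<Union>C" if "s \<in> \<Union>C" for r s
        using that sub unfolding is_left_ideal_def by blast
      fix s t assume "s \<in> \<Union>C" "t \<in> \<Union>C"
      then obtain X Y where XY: "X \<in> C" "Y \<in> C" "s \<in> X" "t \<in> Y" by auto
      then obtain Z where "Z \<in> C" "s \<in> Z" "t \<in> Z" using chain[of X Y] by auto
      then show "s + t \<in> \<Union>C" using sub unfolding is_left_ideal_def by blast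
    qed
    then show "\<Union>C \<in> ?A" using C(1) sub by auto
  qed
  then obtain M where M: "M \<in> ?A" and max: "\<And>K. K \<in> ?A \<Longrightarrow> M \<subseteq> K \<Longrightarrow> K = M"
    by auto
  have "maximal_left_ideal M"
    unfolding maximal_left_ideal_def using M max by auto
  then show ?thesis using M by auto
qed

text \<open>The quotient by a maximal left ideal is a simple module, so each of its nonzero elements
  generates it.\<close>

lemma maximal_left_ideal_generate:
  assumes M: "maximal_left_ideal M" and w: "w \<notin> M"
  shows "\<exists>u. left_cong M (u * w) t"
proof -
  have ideal: "is_left_ideal M" using M by (simp add: maximal_left_ideal_def)
  note D = is_left_idealD[OF ideal]
  define K where "K = {m + u * w | m u. m \<in> M}"
  have "is_left_ideal K"
    unfolding is_left_ideal_def
  proof (intro conjI ballI allI)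
    show "0 \<in> K"
      unfolding K_def using D(1) by (intro CollectI exI[of _ 0]) simp
    show "s + s' \<in> K" if "s \<in> K" "s' \<in> K" for s s'
    proof -
      from that obtain m u m' u' where "m \<in> M" "m' \<in> M" "s = m + u * w" "s' = m' + u' * w"
        by (auto simp: K_def)
      then show ?thesis unfolding K_def
        by (intro CollectI exI[of _ "m + m'"] exI[of _ "u + u'"]) (simp add: algebra_simps D)
    qed
    show "r * s \<in> K" if "s \<in> K" for r s
    proof -
      from that obtain m u where "m \<in> M" "s = m + u * w" by (auto simp: K_def)
      then show ?thesis unfolding K_def
        by (intro CollectI exI[of _ "r * m"] exI[of _ "r * u"]) (simp add: algebra_simps D)
    qed
  qed
  moreover have "M \<subseteq> K"
  proof
    fix m assume "m \<in> M"
    then show "m \<in> K" unfolding K_def by (intro CollectI exI[of _ m] exI[of _ 0]) simp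
  qed
  moreover have "w \<in> K"
    unfolding K_def using D(1) by (intro CollectI exI[of _ 0] exI[of _ 1]) simp
  ultimately have "1 \<in> K" using M w unfolding maximal_left_ideal_def by blast
  then obtain m u where "m \<in> M" "1 = m + u * w" by (auto simp: K_def)
  then have "1 - u * w \<in> M" by (metis add_diff_cancel_right')
  then have "left_cong M 1 (u * w)" by (simp add: left_cong_def)
  then have "left_cong M (t * (u * w)) (t * 1)"
    by (rule left_cong_mult[OF ideal left_cong_sym[OF ideal]])
  then show ?thesis by (auto simp: mult.assoc[symmetric])
qed


section \<open>Complex numbers as quaternions\<close>

definition quat_of_complex :: "complex \<Rightarrow> quat" where
  "quat_of_complex x = Quat (Re x) (Im x) 0 0"

lemma quat_of_complex_add: "quat_of_complex (x + y) = quat_of_complex x + quat_of_complex y"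
  by (simp add: quat_of_complex_def plus_quat_def)

lemma quat_of_complex_mult: "quat_of_complex (x * y) = quat_of_complex x * quat_of_complex y"
  by (simp add: quat_of_complex_def times_quat_def)

lemma quat_of_complex_1: "quat_of_complex 1 = 1"
  by (simp add: quat_of_complex_def one_quat_def)

lemma quat_decompose:
  "q = quat_of_complex (Complex (qRe q) (qI q)) + quat_of_complex (Complex (qJ q) (qK q)) * Quat 0 0 1 0"
  by (simp add: quat_eq_iff quat_of_complex_def plus_quat_def times_quat_def)

lemma quat_of_real_central: "quat_of_complex (of_real x) * q = q * quat_of_complex (of_real x)"
  by (simp add: quat_eq_iff quat_of_complex_def times_quat_def)


section \<open>Maximal left ideals of rings generated by quaternions and central elements\<close>

text \<open>The embedding \<open>c\<close> need not map into the centre; only the generators \<open>z i\<close> are central. That they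
  generate the ring together with the quaternions is expressed by an induction principle.\<close>

locale quaternion_affine_ring =
  fixes c :: "quat \<Rightarrow> 's::ring_1" and z :: "'i::finite \<Rightarrow> 's"
  assumes c_add: "c (p + q) = c p + c q"
    and c_mult: "c (p * q) = c p * c q"
    and c_1: "c 1 = 1"
    and z_central: "z i * s = s * z i"
    and induct [case_names const add var]:
      "\<lbrakk>\<And>q. P (c q); \<And>s t. P s \<Longrightarrow> P t \<Longrightarrow> P (s + t); \<And>s i. P s \<Longrightarrow> P (s * z i)\<rbrakk> \<Longrightarrow> P s"
begin

abbreviation C :: "complex \<Rightarrow> 's" where "C x \<equiv> c (quat_of_complex x)"

lemma c_0: "c 0 = 0"
  using c_add[of 0 0] by simp

text \<open>Scalars are complex rather than quaternionic because linear independence over a field is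
  needed, and because an algebraically closed field of scalars provides eigenvalues.\<close>

sublocale vector_space "\<lambda>x s. C x * s"
  by unfold_locales
    (simp_all add: distrib_left distrib_right c_add c_mult c_1 quat_of_complex_add
      quat_of_complex_mult quat_of_complex_1 mult.assoc)

lemma C_0: "C 0 = 0"
  using scale_zero_left[of 1] by simp

lemma C_commute: "C x * C y = C y * C x"
  by (simp add: mult.commute flip: c_mult quat_of_complex_mult)

lemma C_real_central: "C (of_real x) * s = s * C (of_real x)"
proof (induction s rule: induct)
  case (const q)
  then show ?case by (simp add: quat_of_real_central flip: c_mult)
next
  case (add s t)
  then show ?case by (simp add: distrib_left distrib_right)
next
  case (var s i)
  then show ?case by (metis mult.assoc z_central)
qed

subsection \<open>Countable dimension\<close>

definition spanning_set :: "'s set" where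
  "spanning_set = (\<lambda>(e, is). c e * prod_list (map z is)) ` ({1, Quat 0 0 1 0} \<times> UNIV)"

lemma countable_spanning_set: "countable spanning_set"
  unfolding spanning_set_def by (intro countable_image countable_SIGMA) auto

lemma span_spanning_set: "s \<in> span spanning_set"
proof (induction s rule: induct)
  case (const q)
  have base: "c 1 \<in> spanning_set" "c (Quat 0 0 1 0) \<in> spanning_set"
    unfolding spanning_set_def
    by (auto intro: rev_image_eqI[of "(1, [])"] rev_image_eqI[of "(Quat 0 0 1 0, [])"])
  have "C x * c 1 + C y * c (Quat 0 0 1 0) \<in> span spanning_set" for x y
    by (intro span_add span_scale span_base base)
  then have "c (quat_of_complex x + quat_of_complex y * Quat 0 0 1 0) \<in> span spanning_set" for x y
    by (simp add: c_add c_mult c_1)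
  then show ?case using quat_decompose[of q] by metis
next
  case (add s t)
  then show ?case by (rule span_add)
next
  case (var s i)
  have gen: "b * z i \<in> spanning_set" if b: "b \<in> spanning_set" for b
  proof -
    from b obtain e "is" where "e \<in> {1, Quat 0 0 1 0}" "b = c e * prod_list (map z is)"
      unfolding spanning_set_def by auto
    then show ?thesis
      unfolding spanning_set_def by (auto intro!: rev_image_eqI[of "(e, is @ [i])"] simp: mult.assoc)
  qed
  from var show ?case
  proof (induction s rule: span_induct_alt)
    case base
    then show ?case by (simp add: span_zero)
  next
    case (step x b s)
    have "C x * (b * z i) + s * z i \<in> span spanning_set"
      by (intro span_add span_scale span_base gen step)
    then show ?case by (simp add: distrib_right mult.assoc)
  qed
qed

text \<open>Every \<open>u r\<close> lies in the span of a finite subset of a countable spanning set. There are only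
  countably many such subsets, so infinitely many \<open>u r\<close> share one of them.\<close>

lemma real_family_dependent:
  fixes u :: "real \<Rightarrow> 's"
  shows "\<exists>A a k. finite A \<and> k \<in> A \<and> a k \<noteq> 0 \<and> (\<Sum>r\<in>A. C (a r) * u r) = 0"
proof -
  have "\<exists>T. finite T \<and> T \<subseteq> spanning_set \<and> u r \<in> span T" for r
  proof -
    obtain T a where "finite T" "T \<subseteq> spanning_set" "u r = (\<Sum>b\<in>T. C (a b) * b)"
      using span_spanning_set[of "u r"] unfolding span_explicit by blast
    moreover have "(\<Sum>b\<in>T. C (a b) * b) \<in> span T"
      by (intro span_sum span_scale span_base)
    ultimately show ?thesis by auto
  qed
  then obtain T where T: "\<And>r. finite (T r)" "\<And>r. T r \<subseteq> spanning_set" "\<And>r. u r \<in> span (T r)"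
    by metis
  have "\<exists>V. infinite {r. T r = V}"
  proof (rule ccontr)
    assume "\<not> ?thesis"
    then have "countable (\<Union>V\<in>{V. finite V \<and> V \<subseteq> spanning_set}. {r. T r = V})"
      by (intro countable_UN countable_Collect_finite_subset countable_spanning_set countable_finite)
        auto
    moreover have "(\<Union>V\<in>{V. finite V \<and> V \<subseteq> spanning_set}. {r. T r = V}) = UNIV"
      using T by auto
    ultimately show False using uncountable_UNIV_real by simp
  qed
  then obtain V where V: "infinite {r. T r = V}" by blast
  then obtain r0 where "T r0 = V" using not_finite_existsD by auto
  then have finV: "finite V" using T(1) by auto
  obtain A where A: "finite A" "card A = Suc (card V)" "A \<subseteq> {r. T r = V}"
    using infinite_arbitrarily_large[OF V] by blast
  \<comment> \<open>Independence is a property of sets; if the family has a repetition, its relation is explicit.\<close>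
  show ?thesis
  proof (cases "inj_on u A")
    case True
    have "dependent (u ` A)"
    proof (rule ccontr)
      assume "independent (u ` A)"
      moreover have "u ` A \<subseteq> span V" using A(3) T(3) by auto
      ultimately have "card (u ` A) \<le> card V" using independent_span_bound[OF finV] by blast
      then show False using A(2) card_image[OF True] by simp
    qed
    then obtain b k where b: "k \<in> A" "b (u k) \<noteq> 0" "(\<Sum>v\<in>u ` A. C (b v) * v) = 0"
      using A(1) by (auto simp: dependent_finite)
    then show ?thesis
      using A(1) by (intro exI[of _ A] exI[of _ "\<lambda>r. b (u r)"] exI[of _ k]) (simp add: sum.reindex[OF True])
  next
    case False
    then obtain r s where rs: "r \<noteq> s" "u r = u s" by (auto simp: inj_on_def)
    have "(\<Sum>t\<in>{r, s}. C (if t = r then 1 else - 1) * u t) = 0"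
      using rs scale_minus_left[of 1 "u s"] by (simp add: quat_of_complex_1 c_1)
    then show ?thesis
      by (intro exI[of _ "{r, s}"] exI[of _ "\<lambda>t. if t = r then 1 else - 1"] exI[of _ r]) simp
  qed
qed

subsection \<open>Complex polynomials in a central generator\<close>

text \<open>Horner's scheme for the value at \<open>z i\<close>. The ordinary evaluation \<^const>\<open>poly\<close> takes values in
  commutative rings only.\<close>

definition ev :: "'i \<Rightarrow> complex poly \<Rightarrow> 's" where
  "ev i p = fold_coeffs (\<lambda>a s. C a + z i * s) p 0"

lemma ev_0 [simp]: "ev i 0 = 0"
  by (simp add: ev_def)

lemma ev_pCons [simp]: "ev i (pCons a p) = C a + z i * ev i p"
  by (cases "a = 0 \<and> p = 0") (auto simp: ev_def C_0)

lemma ev_add: "ev i (p + q) = ev i p + ev i q"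
  by (induction p q rule: poly_induct2)
    (simp_all add: quat_of_complex_add c_add distrib_left add_ac)

lemma ev_smult: "ev i (smult a p) = C a * ev i p"
proof (induction p)
  case (pCons b p)
  then show ?case
    by (simp add: quat_of_complex_mult c_mult distrib_left) (metis mult.assoc z_central)
qed simp

lemma ev_sum: "ev i (\<Sum>k\<in>A. f k) = (\<Sum>k\<in>A. ev i (f k))"
  by (induction A rule: infinite_finite_induct) (simp_all add: ev_add)

lemma ev_linear_mult: "ev i ([:- a, 1:] * p) = (z i - C a) * ev i p"
proof -
  have "[:- a, 1:] * p = smult (- a) p + pCons 0 p" by simp
  then have "ev i ([:- a, 1:] * p) = C (- a) * ev i p + z i * ev i p"
    by (simp only: ev_add ev_smult ev_pCons C_0 add_0)
  then show ?thesis by (simp add: scale_minus_left left_diff_distrib)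
qed

lemma ev_commute_C: "ev i p * C a = C a * ev i p"
proof (induction p)
  case (pCons b p)
  then show ?case
    by (simp add: distrib_left distrib_right C_commute) (metis mult.assoc z_central)
qed simp

lemma ev_commute_z: "ev i p * z j = z j * ev i p"
  by (simp add: z_central)

text \<open>Were no nonzero polynomial in \<open>z i\<close> to kill the class of \<open>w\<close>, the elements
  \<open>w / (z i - r)\<close> for real \<open>r\<close> would be linearly independent modulo \<open>M\<close>; there are too many of
  them. Only real \<open>r\<close> are used because \<open>u\<close> has to commute with \<open>z i - r\<close>.\<close>

lemma annihilating_polynomial:
  assumes M: "maximal_left_ideal M"
  shows "\<exists>p. p \<noteq> 0 \<and> ev i p * w \<in> M"
proof (cases "\<exists>r. (z i - C (of_real r)) * w \<in> M")
  case True
  then obtain r where "(z i - C (of_real r)) * w \<in> M" ..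
  then have "ev i [:- of_real r, 1:] * w \<in> M"
    using ev_linear_mult[of i "of_real r" 1] by (simp add: one_pCons c_1 quat_of_complex_1 C_0)
  then show ?thesis by (intro exI[of _ "[:- of_real r, 1:]"]) simp
next
  case False
  have ideal: "is_left_ideal M" using M by (simp add: maximal_left_ideal_def)
  note D = is_left_idealD[OF ideal]
  have "\<exists>u. left_cong M (u * ((z i - C (of_real r)) * w)) w" for r
    using maximal_left_ideal_generate[OF M] False by blast
  then obtain u where u: "\<And>r. left_cong M (u r * ((z i - C (of_real r)) * w)) w" by metis
  obtain A a k where A: "finite A" "k \<in> A" "a k \<noteq> 0" "(\<Sum>r\<in>A. C (a r) * u r) = 0"
    using real_family_dependent[of u] by blast
  define g where "g B = (\<Prod>r\<in>B. [:- complex_of_real r, 1:])" for B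
  have g_remove: "g A = [:- of_real r, 1:] * g (A - {r})" if "r \<in> A" for r
    unfolding g_def using A(1) that by (rule prod.remove)
  define p where "p = (\<Sum>r\<in>A. smult (a r) (g (A - {r})))"
  \<comment> \<open>\<open>p\<close> is the numerator of the partial fraction sum of the \<open>a r / (x - r)\<close> over the common
    denominator \<open>g A\<close>; multiplying the relation between the \<open>u r\<close> by \<open>g A\<close> gives \<open>p\<close>.\<close>
  have step: "left_cong M (ev i (g A) * (C (a r) * u r) * w) (ev i (smult (a r) (g (A - {r}))) * w)"
    if "r \<in> A" for r
  proof -
    have "(z i - C (of_real r)) * u r = u r * (z i - C (of_real r))"
      by (simp add: left_diff_distrib right_diff_distrib z_central C_real_central)
    moreover have "(z i - C (of_real r)) * ev i (g (A - {r})) = ev i (g (A - {r})) * (z i - C (of_real r))"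
      by (simp add: left_diff_distrib right_diff_distrib z_central C_real_central)
    ultimately have "ev i (g A) * u r = ev i (g (A - {r})) * (u r * (z i - C (of_real r)))"
      unfolding g_remove[OF that] ev_linear_mult by (simp add: mult.assoc)
    then have "ev i (g A) * (C (a r) * u r) * w
        = C (a r) * (ev i (g (A - {r})) * (u r * ((z i - C (of_real r)) * w)))"
      by (simp add: ev_commute_C flip: mult.assoc) (simp add: mult.assoc)
    moreover have "left_cong M (C (a r) * (ev i (g (A - {r})) * (u r * ((z i - C (of_real r)) * w))))
        (C (a r) * (ev i (g (A - {r})) * w))"
      by (intro left_cong_mult ideal u)
    ultimately show ?thesis by (simp add: ev_smult mult.assoc)
  qed
  have "(\<Sum>r\<in>A. ev i (g A) * (C (a r) * u r) * w - ev i (smult (a r) (g (A - {r}))) * w) \<in> M"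
    by (intro is_left_ideal_sum ideal) (use step in \<open>simp add: left_cong_def\<close>)
  also have "(\<Sum>r\<in>A. ev i (g A) * (C (a r) * u r) * w - ev i (smult (a r) (g (A - {r}))) * w)
      = ev i (g A) * (\<Sum>r\<in>A. C (a r) * u r) * w - ev i p * w"
    by (simp add: p_def ev_sum sum_subtractf sum_distrib_left sum_distrib_right)
  finally have "ev i p * w \<in> M" using D(4) A(4) by fastforce
  moreover have "p \<noteq> 0"
  proof
    \<comment> \<open>At \<open>k\<close> all summands but one vanish.\<close>
    have "poly p (of_real k) = (\<Sum>r\<in>A. a r * poly (g (A - {r})) (of_real k))"
      by (simp add: p_def poly_sum)
    also have "\<dots> = (\<Sum>r\<in>A. if r = k then a k * poly (g (A - {k})) (of_real k) else 0)"
    proof (intro sum.cong refl)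
      fix r assume "r \<in> A"
      have "poly (g (A - {r})) (of_real k) = 0" if "r \<noteq> k"
        unfolding g_def poly_prod using A(1,2) that by (intro prod_zero bexI[of _ k]) auto
      then show "a r * poly (g (A - {r})) (of_real k)
          = (if r = k then a k * poly (g (A - {k})) (of_real k) else 0)" by auto
    qed
    also have "\<dots> = a k * poly (g (A - {k})) (of_real k)" using A by simp
    also have "\<dots> \<noteq> 0" using A(1,3) by (auto simp: g_def poly_prod)
    finally show "p = 0 \<Longrightarrow> False" by auto
  qed
  ultimately show ?thesis by auto
qed

text \<open>Peel off linear factors of \<open>p\<close> for as long as the remaining factor still maps \<open>w\<close> into \<open>M\<close>. As
  \<open>w\<close> itself is not in \<open>M\<close>, this stops before the factors are exhausted. That the eigenvector has the
  form \<open>ev i q * w\<close> is what lets it inherit eigenvalues of \<open>w\<close> under other generators.\<close>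

lemma eigenvector_of_polynomial:
  assumes "is_left_ideal M" "w \<notin> M" "p \<noteq> 0" "ev i p * w \<in> M"
  shows "\<exists>q a. ev i q * w \<notin> M \<and> (z i - C a) * (ev i q * w) \<in> M"
  using assms(3,4)
proof (induction "degree p" arbitrary: p)
  case 0
  then obtain a where a: "p = [:a:]" "a \<noteq> 0" by (metis degree_eq_zeroE pCons_0_0)
  then have "C a * w \<in> M" using 0 by simp
  then have "C (inverse a) * (C a * w) \<in> M" by (rule is_left_idealD(3)[OF assms(1)])
  moreover have "C (inverse a) * (C a * w) = w"
    using a(2) scale_scale[of "inverse a" a w] by (simp add: c_1 quat_of_complex_1)
  ultimately show ?case using assms(2) by simp
next
  case (Suc n)
  then obtain a where "poly p a = 0"
    using fundamental_theorem_of_algebra[of p] by (auto simp: constant_degree)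
  then obtain q where q: "p = [:- a, 1:] * q" by (auto simp: poly_eq_0_iff_dvd)
  then have "q \<noteq> 0" using Suc.prems by auto
  then have "degree p = Suc (degree q)" unfolding q by (subst degree_mult_eq) auto
  then have deg: "n = degree q" using Suc.hyps by simp
  show ?case
  proof (cases "ev i q * w \<in> M")
    case True
    then show ?thesis using Suc.hyps(1)[OF deg] \<open>q \<noteq> 0\<close> by blast
  next
    case False
    moreover have "(z i - C a) * (ev i q * w) \<in> M"
      using Suc.prems(2) unfolding q ev_linear_mult by (simp add: mult.assoc)
    ultimately show ?thesis by blast
  qed
qed

text \<open>Induction over the generators: \<open>ev j q\<close> commutes with every \<open>z i - C (a i)\<close>, so passing from \<open>w\<close>
  to \<open>ev j q * w\<close> preserves the eigenvalues already found. This is where the eigenvalues must come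
  from one commutative subfield of the quaternions.\<close>

lemma joint_eigenvector:
  assumes M: "maximal_left_ideal M"
  shows "\<exists>w a. w \<notin> M \<and> (\<forall>i. (z i - C (a i)) * w \<in> M)"
proof -
  have ideal: "is_left_ideal M" using M by (simp add: maximal_left_ideal_def)
  have "\<exists>w a. w \<notin> M \<and> (\<forall>i\<in>J. (z i - C (a i)) * w \<in> M)" if "finite J" for J
    using that
  proof (induction J)
    case empty
    show ?case using M by (auto simp: maximal_left_ideal_def)
  next
    case (insert j J)
    then obtain w a where w: "w \<notin> M" "\<And>i. i \<in> J \<Longrightarrow> (z i - C (a i)) * w \<in> M" by blast
    obtain p where "p \<noteq> 0" "ev j p * w \<in> M" using annihilating_polynomial[OF M] by blast
    then obtain q b where q: "ev j q * w \<notin> M" "(z j - C b) * (ev j q * w) \<in> M"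
      using eigenvector_of_polynomial[OF ideal w(1)] by blast
    have "(z i - C (a i)) * (ev j q * w) \<in> M" if "i \<in> J" for i
    proof -
      have "(z i - C (a i)) * ev j q = ev j q * (z i - C (a i))"
        by (simp add: left_diff_distrib right_diff_distrib ev_commute_C ev_commute_z)
      then have "(z i - C (a i)) * (ev j q * w) = ev j q * ((z i - C (a i)) * w)"
        by (simp flip: mult.assoc)
      then show ?thesis using is_left_idealD(3)[OF ideal w(2)[OF that]] by simp
    qed
    then show ?case
      using q insert.hyps by (intro exI[of _ "ev j q * w"] exI[of _ "a(j := b)"]) auto
  qed
  from this[of UNIV] show ?thesis by simp
qed

text \<open>The weak Nullstellensatz: the joint eigenvector \<open>w\<close> spans the quotient by \<open>M\<close> over the quaternions,
  so the class of \<open>1\<close> is a quaternion multiple of it and the generators act on that class by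
  conjugates of their eigenvalues.\<close>

theorem maximal_left_ideal_point:
  assumes M: "maximal_left_ideal M"
  shows "\<exists>a\<in>commuting_points. \<forall>i. z i - c (a i) \<in> M"
proof -
  have ideal: "is_left_ideal M" and "1 \<notin> M" using M by (simp_all add: maximal_left_ideal_def)
  obtain w b where w: "w \<notin> M" "\<And>i. (z i - C (b i)) * w \<in> M"
    using joint_eigenvector[OF M] by blast
  have eigen: "left_cong M (z i * w) (C (b i) * w)" for i
    using w(2)[of i] by (simp add: left_cong_def left_diff_distrib)
  have zch: "left_cong M (z i * (c h * w)) (c (h * quat_of_complex (b i)) * w)" for i h
    using left_cong_mult[OF ideal eigen, of "c h" i] by (simp add: c_mult mult.assoc z_central)
  have line: "\<exists>h. left_cong M (s * w) (c h * w)" for s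
  proof (induction s rule: induct)
    case (const q)
    show ?case using left_cong_refl[OF ideal] by blast
  next
    case (add s t)
    then obtain h k where "left_cong M (s * w) (c h * w)" "left_cong M (t * w) (c k * w)" by blast
    from left_cong_add[OF ideal this] have "left_cong M ((s + t) * w) (c (h + k) * w)"
      by (simp add: c_add distrib_right)
    then show ?case ..
  next
    case (var s i)
    then obtain h where h: "left_cong M (s * w) (c h * w)" by blast
    have "s * z i * w = z i * (s * w)" by (metis mult.assoc z_central)
    then have "left_cong M (s * z i * w) (z i * (c h * w))"
      using left_cong_mult[OF ideal h] by simp
    from left_cong_trans[OF ideal this zch] show ?case ..
  qed
  obtain u where "left_cong M (u * w) 1" using maximal_left_ideal_generate[OF M w(1)] by blast
  with line[of u] obtain h where h: "left_cong M 1 (c h * w)"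
    using left_cong_trans[OF ideal left_cong_sym[OF ideal]] by blast
  have "h \<noteq> 0" using left_cong_mem[OF ideal h] \<open>1 \<notin> M\<close> is_left_idealD(1)[OF ideal] by (auto simp: c_0)
  define a where "a i = h * quat_of_complex (b i) * inverse h" for i
  have "a i * a j = h * quat_of_complex (b i * b j) * inverse h" for i j
  proof -
    have "a i * a j = h * quat_of_complex (b i) * (inverse h * h) * quat_of_complex (b j) * inverse h"
      by (simp only: a_def mult.assoc)
    then show ?thesis using \<open>h \<noteq> 0\<close> by (simp add: quat_of_complex_mult mult.assoc)
  qed
  then have "a \<in> commuting_points" by (simp add: commuting_points_def mult.commute)
  moreover have "z i - c (a i) \<in> M" for i
  proof -
    have "left_cong M (z i * 1) (z i * (c h * w))" by (intro left_cong_mult ideal h)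
    from left_cong_trans[OF ideal this zch]
    have "left_cong M (z i) (c (h * quat_of_complex (b i)) * w)" by simp
    also have "h * quat_of_complex (b i) = a i * h"
      using \<open>h \<noteq> 0\<close> by (simp add: a_def mult.assoc)
    finally have 1: "left_cong M (z i) (c (a i) * (c h * w))" by (simp add: c_mult mult.assoc)
    have "left_cong M (c (a i) * (c h * w)) (c (a i) * 1)"
      by (rule left_cong_mult[OF ideal left_cong_sym[OF ideal h]])
    from left_cong_trans[OF ideal 1 this] show ?thesis by (simp add: left_cong_def)
  qed
  ultimately show ?thesis by blast
qed

end


section \<open>Adjoining a central indeterminate\<close>

lemma poly_mapping_add_single_induct [case_names zero add single]:
  fixes f :: "'a \<Rightarrow>\<^sub>0 'b::comm_monoid_add"
  assumes "P 0" and "\<And>f g. P f \<Longrightarrow> P g \<Longrightarrow> P (f + g)"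
    and "\<And>k b. P (Poly_Mapping.single k b)"
  shows "P f"
proof (induction f rule: update_induct)
  case const
  then show ?case using assms(1) by simp
next
  case (update f k b)
  have "Poly_Mapping.update k b f = f + Poly_Mapping.single k b"
    using update(1) by (intro poly_mapping_eqI)
      (auto simp: lookup_update lookup_add lookup_single when_def in_keys_iff)
  then show ?case using update assms by simp
qed

text \<open>Polynomials in the new indeterminate \<open>y\<close>, with coefficients in the given polynomial ring; \<open>y\<close> is
  the generator with index \<^const>\<open>None\<close> below.\<close>

type_synonym 'n qpoly_y = "nat \<Rightarrow>\<^sub>0 'n qpoly"

abbreviation const_y :: "'n qpoly \<Rightarrow> 'n qpoly_y" where
  "const_y F \<equiv> Poly_Mapping.single 0 F"

definition gens_y :: "'n option \<Rightarrow> 'n qpoly_y" where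
  "gens_y i = (case i of None \<Rightarrow> Poly_Mapping.single 1 1 | Some m \<Rightarrow> const_y (qvar m))"

lemma lookup_single_mult:
  fixes G :: "nat \<Rightarrow>\<^sub>0 'r::ring_1"
  shows "Poly_Mapping.lookup (Poly_Mapping.single j r * G) k
    = (if j \<le> k then r * Poly_Mapping.lookup G (k - j) else 0)"
  by (induction G rule: poly_mapping_add_single_induct)
    (auto simp: distrib_left lookup_add mult_single lookup_single when_def)

lemma gens_y_central: "gens_y i * s = s * gens_y i"
proof (induction s rule: poly_mapping_add_single_induct)
  case (single k G)
  then show ?case
    by (cases i) (simp_all add: gens_y_def mult_single qvar_central add.commute)
qed (simp_all add: distrib_left distrib_right)

interpretation qpoly_y: quaternion_affine_ring "\<lambda>q. const_y (qconst q)" "gens_y :: 'n::finite option \<Rightarrow> _"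
proof
  show "gens_y i * s = s * gens_y i" for i and s :: "'n qpoly_y" by (rule gens_y_central)
next
  fix P :: "'n qpoly_y \<Rightarrow> bool" and s :: "'n::finite qpoly_y"
  assume const: "\<And>q. P (const_y (qconst q))"
    and add: "\<And>s t. P s \<Longrightarrow> P t \<Longrightarrow> P (s + t)" and var: "\<And>s i. P s \<Longrightarrow> P (s * gens_y i)"
  have zero: "P 0" using const[of 0] by (simp add: qconst_def)
  \<comment> \<open>Generalised over the monomial \<open>l\<close> so that exponent vectors can be built up additively.\<close>
  have shift: "P (const_y (Poly_Mapping.single (l + k) q))"
    if "P (const_y (Poly_Mapping.single l q))" for k l q
    using that
  proof (induction k arbitrary: l rule: poly_mapping_add_single_induct)
    case (add k k')
    then show ?case by (metis add.assoc)
  next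
    case (single m j)
    then show ?case
    proof (induction j)
      case (Suc j)
      from var[OF Suc.IH[OF Suc.prems], of "Some m"] show ?case
        by (simp add: gens_y_def qvar_def mult_single add.assoc flip: single_add)
    qed simp
  qed simp
  have const_y: "P (const_y F)" for F :: "'n qpoly"
  proof (induction F rule: poly_mapping_add_single_induct)
    case (single k q)
    show ?case using shift[of 0 q k] const[of q] by (simp add: qconst_def)
  qed (simp_all add: zero add single_add)
  have power_y: "P (Poly_Mapping.single k F)" for k and F :: "'n qpoly"
  proof (induction k)
    case (Suc k)
    from var[OF this, of None] show ?case by (simp add: gens_y_def mult_single)
  qed (rule const_y)
  show "P s"
    by (induction s rule: poly_mapping_add_single_induct) (simp_all add: zero add power_y)
qed (simp_all add: qconst_def single_add mult_single)


section \<open>Inverting a polynomial\<close>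

text \<open>The left ideal of \<open>R[y]\<close> generated by \<open>I\<close> and \<open>1 - y P\<close>: since \<open>y\<close> is central, \<open>I\<close> generates exactly
  the polynomials in \<open>y\<close> with coefficients in \<open>I\<close>.\<close>

definition rabinowitsch_ideal :: "'n qpoly set \<Rightarrow> 'n qpoly \<Rightarrow> 'n qpoly_y set" where
  "rabinowitsch_ideal I P = {G + Q * (1 - Poly_Mapping.single 1 P) | G Q.
     \<forall>k. Poly_Mapping.lookup G k \<in> I}"

lemma left_ideal_iff: "left_ideal I \<longleftrightarrow> is_left_ideal I"
  by (simp add: left_ideal_def is_left_ideal_def)

lemma is_left_ideal_rabinowitsch_ideal:
  assumes "is_left_ideal I"
  shows "is_left_ideal (rabinowitsch_ideal I P)"
proof -
  note D = is_left_idealD[OF assms]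
  let ?e = "1 - Poly_Mapping.single 1 P :: 'a qpoly_y"
  have coeffs: "\<forall>k. Poly_Mapping.lookup (H * G) k \<in> I"
    if "\<forall>k. Poly_Mapping.lookup G k \<in> I" for G H :: "'a qpoly_y"
    by (induction H rule: poly_mapping_add_single_induct)
      (use that in \<open>simp_all add: D distrib_right lookup_add lookup_single_mult\<close>)
  show ?thesis
    unfolding is_left_ideal_def
  proof (intro conjI ballI allI)
    show "0 \<in> rabinowitsch_ideal I P"
      unfolding rabinowitsch_ideal_def using D(1)
      by (intro CollectI exI[of _ 0]) simp
  next
    fix s t assume "s \<in> rabinowitsch_ideal I P" "t \<in> rabinowitsch_ideal I P"
    then obtain G Q G' Q' where *: "\<forall>k. Poly_Mapping.lookup G k \<in> I" "\<forall>k. Poly_Mapping.lookup G' k \<in> I"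
      "s = G + Q * ?e" "t = G' + Q' * ?e"
      by (auto simp: rabinowitsch_ideal_def)
    then have "s + t = (G + G') + (Q + Q') * ?e" by (simp only: distrib_right add_ac)
    moreover have "\<forall>k. Poly_Mapping.lookup (G + G') k \<in> I" using * by (simp add: lookup_add D)
    ultimately show "s + t \<in> rabinowitsch_ideal I P" unfolding rabinowitsch_ideal_def by blast
  next
    fix H s assume "s \<in> rabinowitsch_ideal I P"
    then obtain G Q where *: "\<forall>k. Poly_Mapping.lookup G k \<in> I" "s = G + Q * ?e"
      by (auto simp: rabinowitsch_ideal_def)
    then have "H * s = H * G + (H * Q) * ?e" by (simp add: distrib_left mult.assoc)
    then show "H * s \<in> rabinowitsch_ideal I P"
      using coeffs[OF *(1)] unfolding rabinowitsch_ideal_def by blast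
  qed
qed

text \<open>Formally, \<open>P\<^sup>-\<^sup>1\<close> is substituted for \<open>y\<close> to the right of the coefficients, and the result is
  multiplied by \<open>P ^ N\<close> on the right. Terms of degree above \<open>N\<close> are dropped.\<close>

definition clear_inverse :: "'n qpoly \<Rightarrow> nat \<Rightarrow> 'n qpoly_y \<Rightarrow> 'n qpoly" where
  "clear_inverse P N s = (\<Sum>k\<le>N. Poly_Mapping.lookup s k * P ^ (N - k))"

lemma clear_inverse_add: "clear_inverse P N (s + t) = clear_inverse P N s + clear_inverse P N t"
  by (simp add: clear_inverse_def lookup_add distrib_right sum.distrib)

lemma clear_inverse_single:
  "k \<le> N \<Longrightarrow> clear_inverse P N (Poly_Mapping.single k r) = r * P ^ (N - k)"
  by (simp add: clear_inverse_def lookup_single when_def if_distrib[of "\<lambda>x. x * _"] sum.delta' cong: if_cong)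

text \<open>Under the substitution, \<open>r y\<^sup>k (1 - y P) = r y\<^sup>k - (r P) y\<^sup>k\<^sup>+\<^sup>1\<close> becomes
  \<open>r P\<^sup>N\<^sup>-\<^sup>k - r P P\<^sup>N\<^sup>-\<^sup>k\<^sup>-\<^sup>1 = 0\<close>, provided that the truncation at \<open>N\<close> does not cut off the second term;
  hence the bound on the degree of \<open>Q\<close>.\<close>

lemma clear_inverse_relation:
  assumes "\<And>k. k \<in> Poly_Mapping.keys Q \<Longrightarrow> k < N"
  shows "clear_inverse P N (Q * (1 - Poly_Mapping.single 1 P)) = 0"
  using assms
proof (induction Q rule: update_induct)
  case const
  then show ?case by (simp add: clear_inverse_def)
next
  case (update Q k r)
  have upd: "Poly_Mapping.update k r Q = Q + Poly_Mapping.single k r"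
    using update(1) by (intro poly_mapping_eqI)
      (auto simp: lookup_update lookup_add lookup_single when_def in_keys_iff)
  have k: "k < N" using update by (intro update.prems) (simp add: keys_update)
  have IH: "clear_inverse P N (Q * (1 - Poly_Mapping.single 1 P)) = 0"
    using update by (intro update.IH update.prems) (auto simp: keys_update)
  have "Poly_Mapping.single k r * (1 - Poly_Mapping.single 1 P)
      = Poly_Mapping.single k r + Poly_Mapping.single (Suc k) (- (r * P))"
    by (simp add: right_diff_distrib mult_single single_uminus)
  moreover have "P ^ (N - k) = P * P ^ (N - Suc k)" using k by (metis Suc_diff_Suc power_Suc)
  ultimately have "clear_inverse P N (Poly_Mapping.single k r * (1 - Poly_Mapping.single 1 P)) = 0"
    using k by (simp add: clear_inverse_add clear_inverse_single mult.assoc)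
  then show ?case using IH by (simp add: upd distrib_right clear_inverse_add)
qed

text \<open>Applying \<open>clear_inverse P N\<close> to \<open>1 = G + Q (1 - y P)\<close> kills the second summand as soon as
  \<open>N\<close> exceeds the degree of \<open>Q\<close> in \<open>y\<close>; what remains is the desired expression for \<open>P ^ N\<close>.\<close>

lemma one_in_rabinowitsch_ideal:
  fixes P :: "'n qpoly"
  assumes "1 \<in> rabinowitsch_ideal I P"
  shows "\<exists>N\<ge>1. P ^ N \<in> power_sum_set I P N"
proof -
  obtain G Q :: "'n qpoly_y" where G: "\<And>k. Poly_Mapping.lookup G k \<in> I"
    and 1: "1 = G + Q * (1 - Poly_Mapping.single 1 P)"
    using assms unfolding rabinowitsch_ideal_def by blast
  obtain m where m: "\<And>k. k \<in> Poly_Mapping.keys Q \<Longrightarrow> k < m"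
    using finite_nat_set_iff_bounded[of "Poly_Mapping.keys Q"] by auto
  \<comment> \<open>The successor guarantees \<open>N \<ge> 1\<close> even when \<open>Q = 0\<close>.\<close>
  define N where "N = Suc m"
  have "P ^ N = clear_inverse P N 1"
    using clear_inverse_single[of 0 N P 1] by simp
  also have "\<dots> = clear_inverse P N (G + Q * (1 - Poly_Mapping.single 1 P))"
    by (subst 1) (rule refl)
  also have "\<dots> = clear_inverse P N G"
    using clear_inverse_relation[of Q N P] m by (simp add: clear_inverse_add N_def less_Suc_eq)
  also have "\<dots> = (\<Sum>k\<le>N. Poly_Mapping.lookup G (N - k) * P ^ k)"
    unfolding clear_inverse_def
    by (rule sum.reindex_bij_witness[of _ "\<lambda>k. N - k" "\<lambda>k. N - k"]) auto
  finally have "P ^ N \<in> power_sum_set I P N"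
    unfolding power_sum_set_def using G
    by (intro CollectI exI[of _ "\<lambda>k. Poly_Mapping.lookup G (N - k)"]) simp
  then show ?thesis by (intro exI[of _ N]) (simp add: N_def)
qed


section \<open>Evaluation at commuting points\<close>

lemma qeval_eqI:
  "p \<in> commuting_points \<Longrightarrow> F - qconst d \<in> point_ideal p \<Longrightarrow> qeval F p = d"
  unfolding qeval_def using ex1_qeval by (blast intro: the1_equality)

lemma qeval_eq_0_iff:
  assumes "p \<in> commuting_points"
  shows "qeval F p = 0 \<longleftrightarrow> F \<in> point_ideal p"
  using qeval_eqI[OF assms, of F 0] qeval_in_point_ideal[OF assms, of F] by (auto simp: qconst_def)

lemma qeval_qconst_mult:
  assumes "p \<in> commuting_points"
  shows "qeval (qconst a * F) p = a * qeval F p"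
proof (rule qeval_eqI[OF assms])
  have "qconst a * (F - qconst (qeval F p)) \<in> point_ideal p"
    by (intro point_ideal_mult qeval_in_point_ideal assms)
  then show "qconst a * F - qconst (a * qeval F p) \<in> point_ideal p"
    by (simp add: right_diff_distrib qconst_def mult_single)
qed

text \<open>If \<open>P \<equiv> 1\<close> modulo \<open>m\<^sub>p\<close>, then \<open>G P \<equiv> G\<close> for every \<open>G\<close>, because \<open>m\<^sub>p\<close> absorbs factors on the left. So
  membership of \<open>P ^ N\<close> in \<open>I + I P + \<dots> + I P\<^sup>N\<close> would put \<open>1\<close> into \<open>m\<^sub>p\<close>.\<close>

lemma power_sum_set_qeval:
  assumes p: "p \<in> zero_locus I" and N: "P ^ N \<in> power_sum_set I P N"
  shows "qeval P p \<noteq> 1"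
proof
  assume 1: "qeval P p = 1"
  let ?J = "point_ideal p"
  have comm: "p \<in> commuting_points" and IJ: "I \<subseteq> ?J"
    using p qeval_eq_0_iff by (auto simp: zero_locus_def)
  have J: "is_left_ideal ?J" using left_ideal_point_ideal left_ideal_iff by blast
  have P: "left_cong ?J P 1"
    using qeval_in_point_ideal[OF comm, of P] 1 by (simp add: left_cong_def qconst_def)
  have shift: "left_cong ?J (G * P ^ k) G" for G k
  proof (induction k)
    case (Suc k)
    have "left_cong ?J (G * P ^ k * P) (G * P ^ k * 1)" by (intro left_cong_mult J P)
    then show ?case using left_cong_trans[OF J _ Suc] by (simp add: power_Suc2 mult.assoc del: power_Suc)
  qed (simp add: left_cong_refl J)
  obtain G where G: "\<forall>k\<le>N. G k \<in> I" "P ^ N = (\<Sum>k\<le>N. G k * P ^ k)"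
    using N by (auto simp: power_sum_set_def)
  have "P ^ N \<in> ?J"
    unfolding G(2) using G(1) IJ by (intro is_left_ideal_sum J left_cong_mem[OF J shift]) auto
  then have "1 \<in> ?J" using left_cong_mem[OF J left_cong_sym[OF J shift[of 1 N]]] by simp
  then show False using qconst_in_point_ideal[OF comm, of 1] by (simp add: qconst_def)
qed

lemma const_y_point_ideal:
  assumes M: "is_left_ideal M" and x: "\<And>m. const_y (qvar m - qconst (p m)) \<in> M"
    and F: "F \<in> point_ideal p"
  shows "const_y F \<in> M"
proof -
  obtain G where "F = (\<Sum>m\<in>UNIV. G m * (qvar m - qconst (p m)))"
    using F by (auto simp: point_ideal_def)
  moreover have "const_y (sum f A) = (\<Sum>m\<in>A. const_y (f m))" for f :: "'a \<Rightarrow> 'a qpoly" and A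
    by (induction A rule: infinite_finite_induct) (simp_all add: single_add)
  ultimately have "const_y F = (\<Sum>m\<in>UNIV. const_y (G m) * const_y (qvar m - qconst (p m)))"
    by (simp add: mult_single)
  then show ?thesis using is_left_idealD(3)[OF M x] by (simp add: is_left_ideal_sum[OF M])
qed

text \<open>Rabinowitsch's trick. A maximal left ideal over the one generated by \<open>I\<close> and \<open>1 - y P\<close> would
  contain \<open>m\<^sub>p\<close> for a zero \<open>p\<close> of \<open>I\<close>, hence also \<open>P\<close>, \<open>y P\<close> and \<open>1\<close>.\<close>

theorem vanishing_imp_power_sum_set:
  assumes I: "is_left_ideal I" and vanish: "\<And>p. p \<in> zero_locus I \<Longrightarrow> qeval P p = 0"
  shows "\<exists>N\<ge>1. P ^ N \<in> power_sum_set I P N"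
proof (rule one_in_rabinowitsch_ideal, rule ccontr)
  let ?L = "rabinowitsch_ideal I P"
  assume "1 \<notin> ?L"
  then obtain M where M: "maximal_left_ideal M" and LM: "?L \<subseteq> M"
    using ex_maximal_left_ideal is_left_ideal_rabinowitsch_ideal[OF I] by blast
  have ideal: "is_left_ideal M" and "1 \<notin> M" using M by (simp_all add: maximal_left_ideal_def)
  note D = is_left_idealD[OF ideal]
  have "0 \<in> I" using is_left_idealD(1)[OF I] .
  obtain a where a: "a \<in> commuting_points" "\<And>i. gens_y i - const_y (qconst (a i)) \<in> M"
    using qpoly_y.maximal_left_ideal_point[OF M] by blast
  define p where "p m = a (Some m)" for m
  have p: "p \<in> commuting_points" using a(1) by (simp add: p_def commuting_points_def)
  have x: "const_y (qvar m - qconst (p m)) \<in> M" for m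
    using a(2)[of "Some m"] by (simp add: gens_y_def p_def single_diff)
  note in_M = const_y_point_ideal[OF ideal x]
  \<comment> \<open>\<open>G\<close> and \<open>G - G(p)\<close> both lie in \<open>M\<close>, which contains no unit.\<close>
  have "qeval G p = 0" if "G \<in> I" for G
  proof (rule ccontr)
    assume nz: "qeval G p \<noteq> 0"
    have "const_y G = const_y G + 0 * (1 - Poly_Mapping.single 1 P)"
      "\<forall>k. Poly_Mapping.lookup (const_y G) k \<in> I"
      using that \<open>0 \<in> I\<close> by (simp_all add: lookup_single when_def)
    then have "const_y G \<in> M" using LM unfolding rabinowitsch_ideal_def by blast
    from D(5)[OF this in_M[OF qeval_in_point_ideal[OF p, of G]]]
    have "const_y (qconst (qeval G p)) \<in> M" by (simp add: single_diff)
    from D(3)[OF this, of "const_y (qconst (inverse (qeval G p)))"] nz \<open>1 \<notin> M\<close>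
    show False by (simp add: mult_single qconst_def)
  qed
  then have "qeval P p = 0" using p vanish by (simp add: zero_locus_def)
  then have "const_y P \<in> M" using in_M qeval_eq_0_iff[OF p] by blast
  from D(3)[OF this, of "Poly_Mapping.single 1 1"] have "Poly_Mapping.single 1 P \<in> M"
    by (simp add: mult_single)
  moreover have "1 - Poly_Mapping.single 1 P \<in> ?L"
    unfolding rabinowitsch_ideal_def using \<open>0 \<in> I\<close>
    by (intro CollectI exI[of _ 0] exI[of _ 1]) simp
  ultimately show False using D(2) LM \<open>1 \<notin> M\<close> by fastforce
qed

theorem theorem1p2:
  fixes I :: "'n::finite qpoly set" and F :: "'n qpoly"
  assumes "left_ideal I"
  shows "(\<forall>p \<in> zero_locus I. qeval F p = 0) \<longleftrightarrow>
         (\<forall>a :: quat. \<exists>N \<ge> 1. (qconst a * F) ^ N \<in> power_sum_set I (qconst a * F) N)"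
proof
  assume *: "\<forall>p \<in> zero_locus I. qeval F p = 0"
  show "\<forall>a :: quat. \<exists>N \<ge> 1. (qconst a * F) ^ N \<in> power_sum_set I (qconst a * F) N"
    using assms * by (intro allI vanishing_imp_power_sum_set)
      (auto simp: left_ideal_iff qeval_qconst_mult zero_locus_def)
next
  assume *: "\<forall>a :: quat. \<exists>N \<ge> 1. (qconst a * F) ^ N \<in> power_sum_set I (qconst a * F) N"
  show "\<forall>p \<in> zero_locus I. qeval F p = 0"
  proof (intro ballI, rule ccontr)
    fix p assume p: "p \<in> zero_locus I" and nz: "qeval F p \<noteq> 0"
    then have "qeval (qconst (inverse (qeval F p)) * F) p = 1"
      by (simp add: qeval_qconst_mult zero_locus_def)
    then show False using * power_sum_set_qeval[OF p] by blast
  qed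
qed

end
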